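(* Let $\Sigma_{\mathcal P}\sim(A,B,C,D)$ be a poset-causal system with underlying poset $\mathcal P=(P,\succeq)$, $P=\{1,\dots,p\}$, state space $\mathcal X=\bigoplus_{j\in P}\mathcal X_j$ and reachable subspace $\mathcal R=\mathcal R(A,B)$, and let $\overline{\mathcal R}$, $\mathcal R^\circ$, $\widetilde{\mathcal R}$ be the associated structured subspaces. Then $$\overline{\mathcal R}\subseteq \mathcal R^\circ\subseteq \mathcal R\subseteq\widetilde{\mathcal R}.$$ In particular, if $\Sigma_{\mathcal P}$ is independently controllable, then $\Sigma_{\mathcal P}$ is controllable, and if $\Sigma_{\mathcal P}$ is controllable, then $\Sigma_{\mathcal P}$ is weakly upstream controllable. Furthermore, if $$\mathcal Q=\bigoplus_{j\in P}\mathcal Q_j\quad\text{and}\quad \mathcal S=\bigoplus_{j\in P}\mathcal S_j\quad\text{are such that}\quad \mathcal Q\subseteq\mathcal R\subseteq\mathcal S,$$ where $\mathcal Q_j\subseteq\mathcal X_j$ and $\mathcal S_j\subseteq\mathcal X_j$ are subspaces for each $j\in P$, then $\mathcal Q\subseteq\mathcal R^\circ$ and $\widetilde{\mathcal R}\subseteq\mathcal S$.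
   Context: Let $\mathcal P=(P,\succeq)$ be a partially ordered set with $P=\{1,\dots,p\}$. For $i\in P$ put ${\downarrow}i=\{j\in P: i\succeq j\}$ and ${\uparrow}i=\{j\in P: j\succeq i\}$. A partition is a tuple $\underline n=(n_1,\dots,n_p)$ of nonnegative integers. $\mathcal I_{\mathcal P}^{\underline n\times\underline m}$ is the space of real block matrices $G=[G_{ij}]_{i,j=1}^p$ with $G_{ij}\in\mathbb R^{n_i\times m_j}$ and $G_{ij}=0$ whenever $j\not\succeq i$. For $R,S\subseteq P$, $G(R,S)$ is the block submatrix of $G$ with block rows indexed by $R$ and block columns indexed by $S$ (a singleton $\{i\}$ is written $i$). A poset-causal system $\Sigma_{\mathcal P}\sim(A,B,C,D)$ is the linear system $\dot x=Ax+Bu$, $y=Cx+Du$ with $A\in\mathcal I_{\mathcal P}^{\underline n\times\underline n}$, $B\in\mathcal I_{\mathcal P}^{\underline n\times\underline m}$, $C\in\mathcal I_{\mathcal P}^{\underline r\times\underline n}$, $D\in\mathcal I_{\mathcal P}^{\underline r\times\underline m}$. Local state spaces are $\mathcal X_i=\mathbb R^{n_i}$, and $\mathcal X=\bigoplus_{i\in P}\mathcal X_i$ (orthogonal direct sum); for $S\subseteq P$, $\mathcal X_S=\bigoplus_{j\in S}\mathcal X_j$, viewed as a subspace of $\mathcal X$. $P_{\mathcal X_i}$ is the orthogonal projection onto $\mathcal X_i$. For a pair $(A,B)$ with $A$ of size $N\times N$, $\mathcal R(A,B)=\operatorname{Im}[B\ AB\ \cdots\ A^{N-1}B]$. Write $\mathcal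 R=\mathcal R(A,B)$; the system is controllable if $\mathcal R=\mathcal X$. The $i$-downstream reachable set is $\mathcal R_i=\mathcal R(A({\downarrow}i,{\downarrow}i),B({\downarrow}i,i))\subseteq\mathcal X_{{\downarrow}i}$. For $j\in P$ and $i\in{\downarrow}j$ put $\overline{\mathcal R}_i^j=\mathcal X_i\cap\mathcal R_j$ and $\widetilde{\mathcal R}_i^j=P_{\mathcal X_i}\mathcal R_j$. For $j\in P$ put $$\overline{\mathcal R}_j=\sum_{i\in{\uparrow}j}\overline{\mathcal R}_j^i,\qquad \mathcal R^\circ_j=\mathcal X_j\cap\mathcal R,\qquad \widetilde{\mathcal R}_j=\sum_{i\in{\uparrow}j}\widetilde{\mathcal R}_j^i,$$ and $\overline{\mathcal R}=\bigoplus_{j\in P}\overline{\mathcal R}_j$, $\mathcal R^\circ=\bigoplus_{j\in P}\mathcal R^\circ_j$, $\widetilde{\mathcal R}=\bigoplus_{j\in P}\widetilde{\mathcal R}_j$. The system is independently controllable if $\overline{\mathcal R}=\mathcal X$ and weakly upstream controllable if $\widetilde{\mathcal R}=\mathcal X$. *)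

theory Defs
  imports
    "Jordan_Normal_Form.VS_Connect"
    "Jordan_Normal_Form.DL_Submatrix"
begin

section \<open>Block-partitioned vectors and matrices\<close>

text \<open>
  A partition is a function \<open>n :: nat \<Rightarrow> nat\<close> of which only the values on
  \<open>{1..p}\<close> matter; blocks may be empty.  Block matrices and block vectors are flat
  matrices and vectors in which the blocks are laid out in the order \<open>1, \<dots>, p\<close>, so the
  \<open>k\<close>-th entry of block \<open>i\<close> (both \<open>k\<close> and flat indices counting from 0) has the flat
  index \<open>n 1 + \<dots> + n (i - 1) + k\<close>.
\<close>

definition total :: "nat \<Rightarrow> (nat \<Rightarrow> nat) \<Rightarrow> nat" where
  "total p n = (\<Sum>i = 1..p. n i)"

definition block_indices :: "(nat \<Rightarrow> nat) \<Rightarrow> nat set \<Rightarrow> nat set" where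
  "block_indices n S = {(\<Sum>l \<in> {1..<i}. n l) + k | i k. i \<in> S \<and> k < n i}"

definition block_submatrix ::
  "(nat \<Rightarrow> nat) \<Rightarrow> (nat \<Rightarrow> nat) \<Rightarrow> real mat \<Rightarrow> nat set \<Rightarrow> nat set \<Rightarrow> real mat" where
  "block_submatrix n m G R S = submatrix G (block_indices n R) (block_indices m S)"

text \<open>
  A pair \<open>(j, i) \<in> ord\<close> stands for \<open>j \<succeq> i\<close>.
\<close>

definition incidence_mat ::
  "nat \<Rightarrow> nat rel \<Rightarrow> (nat \<Rightarrow> nat) \<Rightarrow> (nat \<Rightarrow> nat) \<Rightarrow> real mat set" where
  "incidence_mat p ord n m =
     {G \<in> carrier_mat (total p n) (total p m).
        \<forall>i \<in> {1..p}. \<forall>j \<in> {1..p}. (j, i) \<notin> ord \<longrightarrow>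
          block_submatrix n m G {i} {j} = 0\<^sub>m (n i) (m j)}"

text \<open>
  The vectors of dimension \<open>card I\<close> are viewed as vectors of dimension \<open>N\<close> supported in
  \<open>I \<subseteq> {..<N}\<close>.  The entries are placed in increasing order of position, which is the
  enumeration used by \<^const>\<open>submatrix\<close>.
\<close>

definition embed_vec :: "nat \<Rightarrow> nat set \<Rightarrow> real vec \<Rightarrow> real vec" where
  "embed_vec N I v = vec N (\<lambda>a. if a \<in> I then v $ card {b \<in> I. b < a} else 0)"

section \<open>Subspaces of real coordinate space\<close>

abbreviation is_subspace :: "nat \<Rightarrow> real vec set \<Rightarrow> bool" where
  "is_subspace N W \<equiv> VectorSpace.subspace class_ring W (module_vec TYPE(real) N)"

text \<open>
  The sum of a finite family of subspaces.  When \<open>V i\<close> is contained in the \<open>i\<close>-th block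
  for each \<open>i\<close>, this is their (internal, orthogonal) direct sum.
\<close>

definition subspace_Sum :: "nat \<Rightarrow> nat set \<Rightarrow> (nat \<Rightarrow> real vec set) \<Rightarrow> real vec set" where
  "subspace_Sum N I V = {finsum_vec TYPE(real) N v I | v. \<forall>i \<in> I. v i \<in> V i}"

definition orth_proj :: "real vec set \<Rightarrow> real vec \<Rightarrow> real vec" where
  "orth_proj W v = (THE w. w \<in> W \<and> (\<forall>u \<in> W. (v - w) \<bullet> u = 0))"

definition mat_image :: "real mat \<Rightarrow> real vec set" where
  "mat_image M = (\<lambda>u. M *\<^sub>v u) ` carrier_vec (dim_col M)"

text \<open>The matrix \<open>[B, A B, \<dots>, A^(N-1) B]\<close>, where \<open>A\<close> has size \<open>N \<times> N\<close>.\<close>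

definition reachability_mat :: "real mat \<Rightarrow> real mat \<Rightarrow> real mat" where
  "reachability_mat A B =
     mat_of_cols (dim_row A) (concat (map (\<lambda>k. cols (A ^\<^sub>m k * B)) [0..<dim_row A]))"

definition reachable :: "real mat \<Rightarrow> real mat \<Rightarrow> real vec set" where
  "reachable A B = mat_image (reachability_mat A B)"

section \<open>Poset-causal systems\<close>

record poset_system =
  psize :: nat
  geq :: "nat rel"
  nst :: "nat \<Rightarrow> nat"
  nin :: "nat \<Rightarrow> nat"
  nout :: "nat \<Rightarrow> nat"
  sysA :: "real mat"
  sysB :: "real mat"
  sysC :: "real mat"
  sysD :: "real mat"

definition nodes :: "poset_system \<Rightarrow> nat set" where
  "nodes \<Sigma> = {1..psize \<Sigma>}"

definition poset_causal_system :: "poset_system \<Rightarrow> bool" where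
  "poset_causal_system \<Sigma> \<longleftrightarrow>
     partial_order_on (nodes \<Sigma>) (geq \<Sigma>) \<and>
     sysA \<Sigma> \<in> incidence_mat (psize \<Sigma>) (geq \<Sigma>) (nst \<Sigma>) (nst \<Sigma>) \<and>
     sysB \<Sigma> \<in> incidence_mat (psize \<Sigma>) (geq \<Sigma>) (nst \<Sigma>) (nin \<Sigma>) \<and>
     sysC \<Sigma> \<in> incidence_mat (psize \<Sigma>) (geq \<Sigma>) (nout \<Sigma>) (nst \<Sigma>) \<and>
     sysD \<Sigma> \<in> incidence_mat (psize \<Sigma>) (geq \<Sigma>) (nout \<Sigma>) (nin \<Sigma>)"

definition downset :: "poset_system \<Rightarrow> nat \<Rightarrow> nat set" where
  "downset \<Sigma> i = {j \<in> nodes \<Sigma>. (i, j) \<in> geq \<Sigma>}"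

definition upset :: "poset_system \<Rightarrow> nat \<Rightarrow> nat set" where
  "upset \<Sigma> i = {j \<in> nodes \<Sigma>. (j, i) \<in> geq \<Sigma>}"

definition state_dim :: "poset_system \<Rightarrow> nat" where
  "state_dim \<Sigma> = total (psize \<Sigma>) (nst \<Sigma>)"

definition state_space :: "poset_system \<Rightarrow> real vec set" where
  "state_space \<Sigma> = carrier_vec (state_dim \<Sigma>)"

text \<open>\<open>local_space \<Sigma> S\<close> is the direct sum of the local state spaces of the nodes in \<open>S\<close>, as
  a subspace of the global state space.\<close>

definition local_space :: "poset_system \<Rightarrow> nat set \<Rightarrow> real vec set" where
  "local_space \<Sigma> S =
     {x \<in> state_space \<Sigma>. \<forall>a < state_dim \<Sigma>. a \<notin> block_indices (nst \<Sigma>) S \<longrightarrow> x $ a = 0}"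

definition reach :: "poset_system \<Rightarrow> real vec set" where
  "reach \<Sigma> = reachable (sysA \<Sigma>) (sysB \<Sigma>)"

definition reach_down :: "poset_system \<Rightarrow> nat \<Rightarrow> real vec set" where
  "reach_down \<Sigma> i =
     embed_vec (state_dim \<Sigma>) (block_indices (nst \<Sigma>) (downset \<Sigma> i)) `
       reachable
         (block_submatrix (nst \<Sigma>) (nst \<Sigma>) (sysA \<Sigma>) (downset \<Sigma> i) (downset \<Sigma> i))
         (block_submatrix (nst \<Sigma>) (nin \<Sigma>) (sysB \<Sigma>) (downset \<Sigma> i) {i})"

text \<open>In \<open>reach_bar_comp \<Sigma> j i\<close> and \<open>reach_tilde_comp \<Sigma> j i\<close> the node \<open>j\<close> is the upper and
  \<open>i\<close> the lower index of the usual notation.\<close>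

definition reach_bar_comp :: "poset_system \<Rightarrow> nat \<Rightarrow> nat \<Rightarrow> real vec set" where
  "reach_bar_comp \<Sigma> j i = local_space \<Sigma> {i} \<inter> reach_down \<Sigma> j"

definition reach_tilde_comp :: "poset_system \<Rightarrow> nat \<Rightarrow> nat \<Rightarrow> real vec set" where
  "reach_tilde_comp \<Sigma> j i = orth_proj (local_space \<Sigma> {i}) ` reach_down \<Sigma> j"

definition reach_bar_at :: "poset_system \<Rightarrow> nat \<Rightarrow> real vec set" where
  "reach_bar_at \<Sigma> j = subspace_Sum (state_dim \<Sigma>) (upset \<Sigma> j) (\<lambda>i. reach_bar_comp \<Sigma> i j)"

definition reach_circ_at :: "poset_system \<Rightarrow> nat \<Rightarrow> real vec set" where
  "reach_circ_at \<Sigma> j = local_space \<Sigma> {j} \<inter> reach \<Sigma>"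

definition reach_tilde_at :: "poset_system \<Rightarrow> nat \<Rightarrow> real vec set" where
  "reach_tilde_at \<Sigma> j = subspace_Sum (state_dim \<Sigma>) (upset \<Sigma> j) (\<lambda>i. reach_tilde_comp \<Sigma> i j)"

definition block_sum :: "poset_system \<Rightarrow> (nat \<Rightarrow> real vec set) \<Rightarrow> real vec set" where
  "block_sum \<Sigma> V = subspace_Sum (state_dim \<Sigma>) (nodes \<Sigma>) V"

definition reach_bar :: "poset_system \<Rightarrow> real vec set" where
  "reach_bar \<Sigma> = block_sum \<Sigma> (reach_bar_at \<Sigma>)"

definition reach_circ :: "poset_system \<Rightarrow> real vec set" where
  "reach_circ \<Sigma> = block_sum \<Sigma> (reach_circ_at \<Sigma>)"

definition reach_tilde :: "poset_system \<Rightarrow> real vec set" where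
  "reach_tilde \<Sigma> = block_sum \<Sigma> (reach_tilde_at \<Sigma>)"

definition controllable :: "poset_system \<Rightarrow> bool" where
  "controllable \<Sigma> \<longleftrightarrow> reach \<Sigma> = state_space \<Sigma>"

definition independently_controllable :: "poset_system \<Rightarrow> bool" where
  "independently_controllable \<Sigma> \<longleftrightarrow> reach_bar \<Sigma> = state_space \<Sigma>"

definition weakly_upstream_controllable :: "poset_system \<Rightarrow> bool" where
  "weakly_upstream_controllable \<Sigma> \<longleftrightarrow> reach_tilde \<Sigma> = state_space \<Sigma>"

end

theory Submission
  imports Defs
begin

text \<open>
  By transitivity of the order, the space of the nodes below \<open>j\<close> is invariant under the state
  matrix and contains the image of the inputs at \<open>j\<close>.  Hence the downstream reachable set of \<open>j\<close>
  is the subspace generated, under the global dynamics, by the inputs at \<open>j\<close> alone, and the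
  reachable subspace is the sum of the downstream reachable sets over all \<open>j\<close>.  The
  inclusions then follow by intersecting with, or projecting onto, the local state spaces.  The
  downstream sets are computed with fewer powers of the state matrix than the global one; that
  this is harmless is the usual consequence of the Cayley-Hamilton theorem, obtained here from a
  linear dependence among \<open>b, A b, \<dots>, A^N b\<close>.
\<close>

section \<open>Subspaces\<close>

text \<open>Bridges the locale-based notion of the library, stated for the record
  \<open>module_vec\<close>, to closure conditions that automation can use. All later subspace
  proofs go through this form.\<close>

lemma is_subspace_iff:
  "is_subspace N W \<longleftrightarrow> W \<subseteq> carrier_vec N \<and> 0\<^sub>v N \<in> W \<and>
    (\<forall>x\<in>W. \<forall>y\<in>W. x + y \<in> W) \<and> (\<forall>c. \<forall>x\<in>W. c \<cdot>\<^sub>v x \<in> W)"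
proof -
  interpret vec_space "TYPE(real)" N .
  show ?thesis
    unfolding VectorSpace.subspace_def submodule_def
    using vectorspace_axioms module_axioms
    by (auto simp: module_vec_simps)
qed

lemma
  assumes "is_subspace N W"
  shows subspace_carrier: "x \<in> W \<Longrightarrow> x \<in> carrier_vec N"
    and subspace_zero: "0\<^sub>v N \<in> W"
    and subspace_add: "x \<in> W \<Longrightarrow> y \<in> W \<Longrightarrow> x + y \<in> W"
    and subspace_smult: "x \<in> W \<Longrightarrow> c \<cdot>\<^sub>v x \<in> W"
  using assms unfolding is_subspace_iff by auto

lemma subspace_finsum:
  assumes W: "is_subspace N W" and "finite I" "\<And>i. i \<in> I \<Longrightarrow> v i \<in> W"
  shows "finsum_vec TYPE(real) N v I \<in> W"
  using assms(2,3)
proof (induction I)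
  case empty
  show ?case using subspace_zero[OF W] by (simp add: finsum_vec_empty)
next
  case (insert i I)
  have "v \<in> I \<rightarrow> carrier_vec N" "v i \<in> carrier_vec N"
    using insert.prems subspace_carrier[OF W] by auto
  from finsum_vec_insert[OF insert.hyps this] insert show ?case
    by (simp add: subspace_add[OF W])
qed

lemma is_subspace_Int:
  "is_subspace N V \<Longrightarrow> is_subspace N W \<Longrightarrow> is_subspace N (V \<inter> W)"
  unfolding is_subspace_iff by auto

lemma linear_zero_vec:
  fixes f :: "real vec \<Rightarrow> real vec"
  assumes "f (0\<^sub>v N) \<in> carrier_vec M" "f (0 \<cdot>\<^sub>v 0\<^sub>v N) = 0 \<cdot>\<^sub>v f (0\<^sub>v N)"
  shows "f (0\<^sub>v N) = 0\<^sub>v M"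
proof -
  have "0 \<cdot>\<^sub>v 0\<^sub>v N = (0\<^sub>v N :: real vec)" by (intro eq_vecI) auto
  moreover have "0 \<cdot>\<^sub>v f (0\<^sub>v N) = 0\<^sub>v M" using assms(1) by (intro eq_vecI) auto
  ultimately show ?thesis using assms(2) by simp
qed

text \<open>Linearity is asked for on the carrier only, because a map such as
  \<open>embed_vec\<close> reads its argument at indices that make sense only for vectors of the
  right dimension.\<close>

lemma is_subspace_image:
  assumes W: "is_subspace N W"
    and f: "\<And>x. x \<in> carrier_vec N \<Longrightarrow> f x \<in> carrier_vec M"
    and add: "\<And>x y. x \<in> carrier_vec N \<Longrightarrow> y \<in> carrier_vec N \<Longrightarrow> f (x + y) = f x + f y"
    and smult: "\<And>c x. x \<in> carrier_vec N \<Longrightarrow> f (c \<cdot>\<^sub>v x) = c \<cdot>\<^sub>v f x"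
  shows "is_subspace M (f ` W)"
  unfolding is_subspace_iff
proof (intro conjI ballI allI)
  note Wc = subspace_carrier[OF W]
  show "f ` W \<subseteq> carrier_vec M" using f Wc by auto
  have "f (0\<^sub>v N) = 0\<^sub>v M" by (rule linear_zero_vec[of f]) (auto intro: f smult)
  then show "0\<^sub>v M \<in> f ` W" using subspace_zero[OF W] by (metis imageI)
  show "x + y \<in> f ` W" if "x \<in> f ` W" "y \<in> f ` W" for x y
    using that add Wc subspace_add[OF W] by (auto simp: image_iff) metis
  show "c \<cdot>\<^sub>v x \<in> f ` W" if "x \<in> f ` W" for c x
    using that smult Wc subspace_smult[OF W] by (auto simp: image_iff) metis
qed

lemma is_subspace_vimage:
  assumes W: "is_subspace M W"
    and f: "\<And>x. x \<in> carrier_vec N \<Longrightarrow> f x \<in> carrier_vec M"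
    and add: "\<And>x y. x \<in> carrier_vec N \<Longrightarrow> y \<in> carrier_vec N \<Longrightarrow> f (x + y) = f x + f y"
    and smult: "\<And>c x. x \<in> carrier_vec N \<Longrightarrow> f (c \<cdot>\<^sub>v x) = c \<cdot>\<^sub>v f x"
  shows "is_subspace N {x \<in> carrier_vec N. f x \<in> W}"
proof -
  have "f (0\<^sub>v N) = 0\<^sub>v M" by (rule linear_zero_vec[of f]) (auto intro: f smult)
  then show ?thesis
    unfolding is_subspace_iff
    using subspace_zero[OF W] subspace_add[OF W] subspace_smult[OF W] by (simp add: add smult)
qed

text \<open>Decompositions are added and scaled summand by summand. The resulting vectors are
  compared entry by entry, where \<open>finsum_vec\<close> becomes an ordinary sum of reals.\<close>

lemma is_subspace_subspace_Sum:
  assumes I: "finite I" and V: "\<And>i. i \<in> I \<Longrightarrow> is_subspace N (V i)"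
  shows "is_subspace N (subspace_Sum N I V)"
  unfolding is_subspace_iff
proof (intro conjI ballI allI)
  have c: "v \<in> I \<rightarrow> carrier_vec N" if "\<forall>i\<in>I. v i \<in> V i" for v
    using that subspace_carrier[OF V] by auto
  show "subspace_Sum N I V \<subseteq> carrier_vec N"
    unfolding subspace_Sum_def using finsum_vec_closed[OF c] by auto
  have "finsum_vec TYPE(real) N (\<lambda>_. 0\<^sub>v N) I = 0\<^sub>v N"
    by (rule eq_vecI)
       (use finsum_vec_closed[of "\<lambda>_. 0\<^sub>v N :: real vec" I N] I in \<open>auto simp: index_finsum_vec\<close>)
  then show "0\<^sub>v N \<in> subspace_Sum N I V"
    unfolding subspace_Sum_def using subspace_zero[OF V]
    by (auto intro!: exI[of _ "\<lambda>_. 0\<^sub>v N"])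
  show "x + y \<in> subspace_Sum N I V" if xy: "x \<in> subspace_Sum N I V" "y \<in> subspace_Sum N I V" for x y
  proof -
    from xy obtain v w where v: "\<forall>i\<in>I. v i \<in> V i" "x = finsum_vec TYPE(real) N v I"
      and w: "\<forall>i\<in>I. w i \<in> V i" "y = finsum_vec TYPE(real) N w I"
      unfolding subspace_Sum_def by auto
    have vw: "\<forall>i\<in>I. v i + w i \<in> V i" using v w subspace_add[OF V] by auto
    have "x + y = finsum_vec TYPE(real) N (\<lambda>i. v i + w i) I"
    proof (rule eq_vecI)
      fix a assume a: "a < dim_vec (finsum_vec TYPE(real) N (\<lambda>i. v i + w i) I)"
      then have a: "a < N" using finsum_vec_closed[OF c[OF vw]] by auto
      have "(\<Sum>i\<in>I. (v i + w i) $ a) = (\<Sum>i\<in>I. v i $ a + w i $ a)"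
        using a c[OF w(1)] by (intro sum.cong) (auto simp: Pi_iff)
      then show "(x + y) $ a = finsum_vec TYPE(real) N (\<lambda>i. v i + w i) I $ a"
        using a finsum_vec_closed[OF c[OF w(1)]]
        by (simp add: v(2) w(2) index_finsum_vec[OF I a] c v(1) w(1) vw sum.distrib)
    qed (use finsum_vec_closed[OF c[OF vw]] finsum_vec_closed[OF c[OF w(1)]] w in auto)
    then show ?thesis unfolding subspace_Sum_def using vw by auto
  qed
  show "k \<cdot>\<^sub>v x \<in> subspace_Sum N I V" if x: "x \<in> subspace_Sum N I V" for k x
  proof -
    from x obtain v where v: "\<forall>i\<in>I. v i \<in> V i" "x = finsum_vec TYPE(real) N v I"
      unfolding subspace_Sum_def by auto
    have kv: "\<forall>i\<in>I. k \<cdot>\<^sub>v v i \<in> V i" using v subspace_smult[OF V] by auto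
    have "k \<cdot>\<^sub>v x = finsum_vec TYPE(real) N (\<lambda>i. k \<cdot>\<^sub>v v i) I"
    proof (rule eq_vecI)
      fix a assume a: "a < dim_vec (finsum_vec TYPE(real) N (\<lambda>i. k \<cdot>\<^sub>v v i) I)"
      then have a: "a < N" using finsum_vec_closed[OF c[OF kv]] by auto
      have "(\<Sum>i\<in>I. (k \<cdot>\<^sub>v v i) $ a) = (\<Sum>i\<in>I. k * v i $ a)"
        using a c[OF v(1)] by (intro sum.cong) (auto simp: Pi_iff)
      then show "(k \<cdot>\<^sub>v x) $ a = finsum_vec TYPE(real) N (\<lambda>i. k \<cdot>\<^sub>v v i) I $ a"
        using a finsum_vec_closed[OF c[OF v(1)]]
        by (simp add: v(2) index_finsum_vec[OF I a] c v(1) kv sum_distrib_left)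
    qed (use finsum_vec_closed[OF c[OF kv]] finsum_vec_closed[OF c[OF v(1)]] v in auto)
    then show ?thesis unfolding subspace_Sum_def using kv by auto
  qed
qed

lemma subspace_Sum_least:
  assumes "is_subspace N W" "finite I" "\<And>i. i \<in> I \<Longrightarrow> V i \<subseteq> W"
  shows "subspace_Sum N I V \<subseteq> W"
  unfolding subspace_Sum_def using assms by (auto intro!: subspace_finsum)

lemma subspace_Sum_mono:
  assumes "\<And>i. i \<in> I \<Longrightarrow> V i \<subseteq> W i"
  shows "subspace_Sum N I V \<subseteq> subspace_Sum N I W"
  unfolding subspace_Sum_def using assms by blast

text \<open>A vector of one summand is completed by zero vectors in all other summands, which is why
  every \<open>V i\<close> has to be a subspace.\<close>

lemma subspace_Sum_upper:
  assumes I: "finite I" "i \<in> I" and V: "\<And>i. i \<in> I \<Longrightarrow> is_subspace N (V i)"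
  shows "V i \<subseteq> subspace_Sum N I V"
proof
  fix x assume x: "x \<in> V i"
  let ?v = "\<lambda>k. if k = i then x else 0\<^sub>v N"
  have x': "x \<in> carrier_vec N" using subspace_carrier[OF V[OF I(2)]] x .
  then have c: "?v \<in> I \<rightarrow> carrier_vec N" by auto
  have "x = finsum_vec TYPE(real) N ?v I"
  proof (rule eq_vecI)
    fix a assume "a < dim_vec (finsum_vec TYPE(real) N ?v I)"
    then have a: "a < N" using finsum_vec_closed[OF c] by auto
    have "(\<Sum>k\<in>I. ?v k $ a) = (\<Sum>k\<in>I. if k = i then x $ a else 0)"
      using a by (intro sum.cong) auto
    then show "x $ a = finsum_vec TYPE(real) N ?v I $ a"
      using I by (simp add: index_finsum_vec[OF I(1) a c])
  qed (use finsum_vec_closed[OF c] x' in auto)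
  moreover have "\<forall>k\<in>I. ?v k \<in> V k" using x subspace_zero[OF V] by auto
  ultimately show "x \<in> subspace_Sum N I V" unfolding subspace_Sum_def by blast
qed

section \<open>Reachable subspaces\<close>

lemma mat_unit_vec_col:
  assumes "(M :: real mat) \<in> carrier_mat N m" "c < m"
  shows "M *\<^sub>v unit_vec m c = col M c"
  using assms by (intro eq_vecI) auto

text \<open>\<open>M *\<^sub>v v\<close> is the combination of the columns of \<open>M\<close> with
  the entries of \<open>v\<close> as coefficients. Restricting the hypothesis to nonzero
  coefficients matters for the power argument below, where only the columns before a certain index
  are known to lie in \<open>W\<close>.\<close>

lemma mult_mat_vec_in_subspace:
  assumes W: "is_subspace N W" and M: "M \<in> carrier_mat N m" and v: "v \<in> carrier_vec m"
    and cols: "\<And>c. c < m \<Longrightarrow> v $ c \<noteq> 0 \<Longrightarrow> col M c \<in> W"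
  shows "M *\<^sub>v v \<in> W"
proof -
  let ?f = "\<lambda>c. v $ c \<cdot>\<^sub>v col M c"
  have c: "?f \<in> {0..<m} \<rightarrow> carrier_vec N" using M by auto
  have "M *\<^sub>v v = finsum_vec TYPE(real) N ?f {0..<m}"
  proof (rule eq_vecI)
    fix a assume "a < dim_vec (finsum_vec TYPE(real) N ?f {0..<m})"
    then have a: "a < N" using finsum_vec_closed[OF c] by auto
    have "(\<Sum>i = 0..<m. ?f i $ a) = (\<Sum>i = 0..<m. row M a $ i * v $ i)"
      using a M by (intro sum.cong) auto
    then show "(M *\<^sub>v v) $ a = finsum_vec TYPE(real) N ?f {0..<m} $ a"
      using a M v by (subst index_finsum_vec[OF _ a c]) (auto simp: scalar_prod_def)
  qed (use finsum_vec_closed[OF c] M in auto)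
  also have "\<dots> \<in> W"
  proof (rule subspace_finsum[OF W])
    fix i assume i: "i \<in> {0..<m}"
    show "?f i \<in> W"
    proof (cases "v $ i = 0")
      case True
      then have "?f i = 0\<^sub>v N" using M i by auto
      then show ?thesis using subspace_zero[OF W] by simp
    next
      case False
      then show ?thesis using cols i subspace_smult[OF W] by auto
    qed
  qed simp
  finally show ?thesis .
qed

lemma is_subspace_carrier: "is_subspace N (carrier_vec N)"
  unfolding is_subspace_iff by auto

lemma is_subspace_mat_image:
  assumes "M \<in> carrier_mat N m"
  shows "is_subspace N (mat_image M)"
proof -
  have "is_subspace N ((\<lambda>u. M *\<^sub>v u) ` carrier_vec m)"
    by (rule is_subspace_image[OF is_subspace_carrier])
       (use assms in \<open>auto simp: mult_add_distrib_mat_vec mult_mat_vec\<close>)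
  then show ?thesis using assms unfolding mat_image_def by auto
qed

section \<open>Linear dependence among powers applied to a vector\<close>

text \<open>Appending a zero row makes the matrix square, and expansion along that row shows that
  the determinant vanishes. A kernel vector of the padded matrix is one of \<open>M\<close>.\<close>

lemma exists_dependent_combination:
  fixes M :: "real mat"
  assumes M: "M \<in> carrier_mat N (Suc N)"
  obtains v where "v \<in> carrier_vec (Suc N)" "v \<noteq> 0\<^sub>v (Suc N)" "M *\<^sub>v v = 0\<^sub>v N"
proof -
  let ?M = "mat (Suc N) (Suc N) (\<lambda>(a, b). if a < N then M $$ (a, b) else 0)"
  have "det ?M = (\<Sum>b<Suc N. ?M $$ (N, b) * cofactor ?M N b)"
    by (rule laplace_expansion_row) auto
  also have "\<dots> = 0" by (rule sum.neutral) auto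
  finally have "det ?M = 0" .
  then obtain v where v: "v \<in> carrier_vec (Suc N)" "v \<noteq> 0\<^sub>v (Suc N)" "?M *\<^sub>v v = 0\<^sub>v (Suc N)"
    using det_0_iff_vec_prod_zero[of ?M "Suc N"] by auto
  have "M *\<^sub>v v = 0\<^sub>v N"
  proof (rule eq_vecI)
    fix a assume "a < dim_vec (0\<^sub>v N :: real vec)"
    then have a: "a < N" by simp
    have "row M a = row ?M a" using a M by (intro eq_vecI) auto
    moreover have "(?M *\<^sub>v v) $ a = 0" using a v(3) by simp
    ultimately show "(M *\<^sub>v v) $ a = 0\<^sub>v N $ a" using a M by simp
  qed (use M in auto)
  with v that show ?thesis by blast
qed

lemma pow_mat_add:
  assumes "A \<in> carrier_mat N N"
  shows "A ^\<^sub>m (i + j) = A ^\<^sub>m i * A ^\<^sub>m j"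
  using assms by (induction j) (auto simp: pow_carrier_mat assoc_mult_mat[of _ N N _ N _ N])

text \<open>Stands in for Cayley-Hamilton. \<open>W\<close> is not assumed invariant under
  \<open>A\<close>, so each high power is rewritten through lower powers by strong induction instead
  of applying \<open>A\<close> to members of \<open>W\<close>.\<close>

lemma power_mult_vec_in_subspace:
  assumes A: "A \<in> carrier_mat N N" and b: "b \<in> carrier_vec N" and W: "is_subspace N W"
    and low: "\<And>k. k < N \<Longrightarrow> A ^\<^sub>m k *\<^sub>v b \<in> W"
  shows "A ^\<^sub>m k *\<^sub>v b \<in> W"
proof -
  note Ak = pow_carrier_mat[OF A]
  define M where "M = mat_of_cols N (map (\<lambda>k. A ^\<^sub>m k *\<^sub>v b) [0..<Suc N])"
  have M: "M \<in> carrier_mat N (Suc N)" unfolding M_def by auto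
  have colM: "col M i = A ^\<^sub>m i *\<^sub>v b" if "i < Suc N" for i
    unfolding M_def by (subst col_mat_of_cols) (use that mult_mat_vec_carrier[OF Ak b] in \<open>auto simp del: upt_Suc\<close>)
  obtain v where v: "v \<in> carrier_vec (Suc N)" "v \<noteq> 0\<^sub>v (Suc N)" "M *\<^sub>v v = 0\<^sub>v N"
    using exists_dependent_combination[OF M] .
  let ?K = "{k. k < Suc N \<and> v $ k \<noteq> 0}"
  have "?K \<noteq> {}" using v(1,2) by (auto intro!: eq_vecI)
  \<comment> \<open>The leading index of the dependence. Since \<open>d\<close> is at most
    \<open>N\<close>, every exponent below \<open>d\<close> is covered by
    \<open>low\<close>.\<close>
  define d where "d = Max ?K"
  have "d \<in> ?K" unfolding d_def using \<open>?K \<noteq> {}\<close> by (intro Max_in) auto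
  then have d: "d < Suc N" "v $ d \<noteq> 0" by auto
  have above: "v $ i = 0" if "d < i" "i < Suc N" for i
    using that Max_ge[of ?K i] unfolding d_def by fastforce
  \<comment> \<open>\<open>A^d b\<close> is a combination of the \<open>A^i b\<close> with \<open>i < d\<close>, hence \<open>A^(r + d) b\<close> one of the
    \<open>A^(r + i) b\<close>.\<close>
  show ?thesis
  proof (induction k rule: less_induct)
    case (less k)
    show ?case
    proof (cases "k < d")
      case True
      then show ?thesis using low d by auto
    next
      case False
      then obtain r where k: "k = r + d" using le_Suc_ex[of d k] by (auto simp: add.commute)
      \<comment> \<open>The columns of \<open>?M\<close> are the vectors
        \<open>A ^\<^sub>m (r + i) *\<^sub>v b\<close>, and \<open>?e\<close> is the leading part of
        \<open>v\<close>. The remainder \<open>v - ?e\<close> only involves columns with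
        \<open>i < d\<close>, whose exponents are below \<open>k\<close>, so the induction
        hypothesis applies to them.\<close>
      let ?M = "A ^\<^sub>m r * M" and ?e = "v $ d \<cdot>\<^sub>v unit_vec (Suc N) d"
      have M': "?M \<in> carrier_mat N (Suc N)" by (rule mult_carrier_mat[OF Ak M])
      have colM': "col ?M i = A ^\<^sub>m (r + i) *\<^sub>v b" if "i < Suc N" for i
        using that Ak M b by (simp add: col_mult2[of _ N N] colM pow_mat_add[OF A]
            assoc_mult_mat_vec[of _ N N _ N])
      have 1: "?M *\<^sub>v (v - ?e) \<in> W"
      proof (rule mult_mat_vec_in_subspace[OF W M'])
        fix i assume i: "i < Suc N" "(v - ?e) $ i \<noteq> 0"
        then have "i < d" using above[of i] v(1) d by (cases i d rule: linorder_cases) auto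
        then show "col ?M i \<in> W" using less i by (simp add: colM' k)
      qed (use v in auto)
      \<comment> \<open>Since \<open>?M\<close> annihilates \<open>v\<close>, this splitting
        expresses the leading term as the negative of the remainder.\<close>
      have e: "?e = v - (v - ?e)" using v(1) by (intro eq_vecI) auto
      have 2: "?M *\<^sub>v v = 0\<^sub>v N"
        using Ak[of r] M v by (simp add: assoc_mult_mat_vec[of _ N N _ "Suc N"])
           (auto intro!: eq_vecI simp: scalar_prod_def)
      have "v $ d \<cdot>\<^sub>v (A ^\<^sub>m k *\<^sub>v b) = ?M *\<^sub>v ?e"
        using d M' by (simp add: k colM'[symmetric] mult_mat_vec[of _ N "Suc N"] mat_unit_vec_col)
      also have "\<dots> = 0\<^sub>v N - ?M *\<^sub>v (v - ?e)"
        using v(1) by (subst e) (simp add: mult_minus_distrib_mat_vec[OF M'] 2)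
      also have "\<dots> = (-1) \<cdot>\<^sub>v (?M *\<^sub>v (v - ?e))"
        using M' by (intro eq_vecI) auto
      also have "\<dots> \<in> W" using 1 by (rule subspace_smult[OF W])
      finally have "(1 / v $ d) \<cdot>\<^sub>v (v $ d \<cdot>\<^sub>v (A ^\<^sub>m k *\<^sub>v b)) \<in> W"
        by (rule subspace_smult[OF W])
      then show ?thesis using d by (simp add: smult_smult_assoc)
    qed
  qed
qed

section \<open>Generators of the reachable subspace\<close>

lemma set_cols_reachability_mat:
  assumes A: "A \<in> carrier_mat N N" and B: "B \<in> carrier_mat N m"
  shows "set (cols (reachability_mat A B)) =
    {A ^\<^sub>m k *\<^sub>v (B *\<^sub>v unit_vec m c) | k c. k < N \<and> c < m}"
proof -
  note Ak = pow_carrier_mat[OF A]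
  have sub: "set (cols (A ^\<^sub>m k * B)) = {A ^\<^sub>m k *\<^sub>v (B *\<^sub>v unit_vec m c) | c. c < m}" for k
  proof -
    have "col (A ^\<^sub>m k * B) c = A ^\<^sub>m k *\<^sub>v (B *\<^sub>v unit_vec m c)" if "c < m" for c
      using that Ak B by (simp add: col_mult2[of _ N N _ m] mat_unit_vec_col[of _ N m])
    moreover have "dim_col (A ^\<^sub>m k * B) = m" using B by simp
    ultimately show ?thesis unfolding cols_def by (auto simp: image_iff)
  qed
  let ?xs = "concat (map (\<lambda>k. cols (A ^\<^sub>m k * B)) [0..<N])"
  have set: "set ?xs = {A ^\<^sub>m k *\<^sub>v (B *\<^sub>v unit_vec m c) | k c. k < N \<and> c < m}"
    by (fastforce simp: sub)
  have "set ?xs \<subseteq> carrier_vec N" unfolding set using Ak B by (auto intro!: mult_mat_vec_carrier)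
  then have "cols (mat_of_cols N ?xs) = ?xs" by (rule cols_mat_of_cols)
  then show ?thesis unfolding reachability_mat_def using A set by simp
qed

lemma is_subspace_reachable:
  assumes "A \<in> carrier_mat N N"
  shows "is_subspace N (reachable A B)"
  unfolding reachable_def
  by (rule is_subspace_mat_image) (use assms in \<open>auto simp: reachability_mat_def\<close>)

lemma mult_mat_vec_unit_vec_induct:
  assumes W: "is_subspace N W" and M: "M \<in> carrier_mat N m" and v: "v \<in> carrier_vec m"
    and "\<And>c. c < m \<Longrightarrow> M *\<^sub>v unit_vec m c \<in> W"
  shows "M *\<^sub>v v \<in> W"
  by (rule mult_mat_vec_in_subspace[OF W M v]) (use assms mat_unit_vec_col[OF M] in auto)

text \<open>Every column of the reachability matrix is one of the generators. Together with
  \<open>power_in_reachable\<close>, this makes \<open>reachable A B\<close> the smallest subspace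
  containing all \<open>A ^\<^sub>m k *\<^sub>v (B *\<^sub>v u)\<close>, a description in which the
  size of \<open>A\<close> no longer bounds the exponents.\<close>

lemma reachable_least:
  assumes A: "A \<in> carrier_mat N N" and B: "B \<in> carrier_mat N m" and W: "is_subspace N W"
    and gen: "\<And>k c. c < m \<Longrightarrow> A ^\<^sub>m k *\<^sub>v (B *\<^sub>v unit_vec m c) \<in> W"
  shows "reachable A B \<subseteq> W"
proof -
  let ?M = "reachability_mat A B"
  have M: "?M \<in> carrier_mat N (dim_col ?M)" using A by (auto simp: reachability_mat_def)
  have "set (cols ?M) \<subseteq> W" unfolding set_cols_reachability_mat[OF A B] using gen by auto
  then have "col ?M c \<in> W" if "c < dim_col ?M" for c using that by (auto simp: cols_def)
  then show ?thesis
    unfolding reachable_def mat_image_def using mult_mat_vec_in_subspace[OF W M] by auto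
qed

text \<open>Unit input vectors with \<open>k < N\<close> give columns of the reachability matrix.
  The dependence argument then removes the bound on \<open>k\<close>, and linearity passes from unit
  vectors to \<open>u\<close>.\<close>

lemma power_in_reachable:
  assumes A: "A \<in> carrier_mat N N" and B: "B \<in> carrier_mat N m" and u: "u \<in> carrier_vec m"
  shows "A ^\<^sub>m k *\<^sub>v (B *\<^sub>v u) \<in> reachable A B"
proof -
  note Ak = pow_carrier_mat[OF A] and W = is_subspace_reachable[OF A, of B]
  let ?M = "reachability_mat A B"
  have "x \<in> reachable A B" if x: "x \<in> set (cols ?M)" for x
  proof -
    obtain c where c: "c < dim_col ?M" "x = col ?M c" using x by (auto simp: cols_def)
    then have "x = ?M *\<^sub>v unit_vec (dim_col ?M) c"
      using mat_unit_vec_col[of ?M "dim_row ?M"] by auto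
    then show ?thesis unfolding reachable_def mat_image_def by auto
  qed
  then have low: "A ^\<^sub>m k *\<^sub>v (B *\<^sub>v unit_vec m c) \<in> reachable A B" if "k < N" "c < m" for k c
    unfolding set_cols_reachability_mat[OF A B] using that by blast
  have all: "A ^\<^sub>m k *\<^sub>v (B *\<^sub>v unit_vec m c) \<in> reachable A B" if "c < m" for c
    by (rule power_mult_vec_in_subspace[OF A _ W low]) (use B that in auto)
  have "(A ^\<^sub>m k * B) *\<^sub>v u \<in> reachable A B"
    by (rule mult_mat_vec_unit_vec_induct[OF W mult_carrier_mat[OF Ak B] u])
       (use Ak B all in \<open>auto simp: assoc_mult_mat_vec[of _ N N _ m]\<close>)
  then show ?thesis using Ak B u by (simp add: assoc_mult_mat_vec[of _ N N _ m])
qed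

section \<open>Embedding of coordinate subspaces\<close>

text \<open>The cardinality on the left is the rank of \<open>a\<close> in \<open>I\<close>, the
  position at which \<open>embed_vec\<close> reads its argument.\<close>

lemma card_less_bound:
  assumes "finite I" "a \<in> I"
  shows "card {b \<in> I. b < (a::nat)} < card I"
  using assms by (intro psubset_card_mono) auto

lemma embed_vec_carrier [simp]: "embed_vec N I v \<in> carrier_vec N"
  by (simp add: embed_vec_def)

lemma embed_vec_add:
  assumes "I \<subseteq> {..<N}" "v \<in> carrier_vec (card I)" "w \<in> carrier_vec (card I)"
  shows "embed_vec N I (v + w) = embed_vec N I v + embed_vec N I w"
  using assms card_less_bound[OF finite_subset[OF assms(1)]]
  by (intro eq_vecI) (auto simp: embed_vec_def)

lemma embed_vec_smult:
  assumes "I \<subseteq> {..<N}" "v \<in> carrier_vec (card I)"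
  shows "embed_vec N I (c \<cdot>\<^sub>v v) = c \<cdot>\<^sub>v embed_vec N I v"
  using assms card_less_bound[OF finite_subset[OF assms(1)]]
  by (intro eq_vecI) (auto simp: embed_vec_def)

lemma embed_vec_unit_vec:
  assumes "I \<subseteq> {..<N}" "b \<in> I"
  shows "embed_vec N I (unit_vec (card I) (card {x \<in> I. x < b})) = unit_vec N b"
proof (rule eq_vecI)
  fix a assume "a < dim_vec (unit_vec N b :: real vec)"
  then have a: "a < N" by simp
  have fin: "finite I" using assms(1) finite_subset by auto
  note lt = card_less_bound[OF fin]
  have "a = b" if "a \<in> I" "card {x \<in> I. x < a} = card {x \<in> I. x < b}"
    using that assms(2) pick_card_in_set by metis
  then show "embed_vec N I (unit_vec (card I) (card {x \<in> I. x < b})) $ a = unit_vec N b $ a"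
    using a lt assms by (auto simp: embed_vec_def unit_vec_def)
qed (simp add: embed_vec_def)

text \<open>\<open>pick J\<close> and the rank in \<open>J\<close> are mutually inverse bijections
  between positions and elements.\<close>

lemma sum_pick:
  assumes "finite J"
  shows "(\<Sum>c = 0..<card J. f (pick J c) c) = (\<Sum>b\<in>J. f b (card {x \<in> J. x < b}))"
  by (rule sum.reindex_bij_witness[of _ "\<lambda>b. card {x \<in> J. x < b}" "pick J"])
     (use assms in \<open>auto simp: card_pick_le pick_in_set_le pick_card_in_set card_less_bound\<close>)

lemma dim_submatrix_subset:
  assumes "M \<in> carrier_mat N m" "I \<subseteq> {..<N}" "J \<subseteq> {..<m}"
  shows "submatrix M I J \<in> carrier_mat (card I) (card J)"
proof -
  have "{i. i < N \<and> i \<in> I} = I" "{j. j < m \<and> j \<in> J} = J" using assms by auto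
  then show ?thesis using assms(1) by (intro carrier_matI) (simp_all add: dim_submatrix)
qed

text \<open>By \<open>zero\<close>, \<open>M\<close> sends vectors supported in \<open>J\<close> to
  vectors supported in \<open>I\<close>, so passing to the submatrix loses nothing: rows in
  \<open>I\<close> agree after reindexing, and rows outside \<open>I\<close> give 0 on both
  sides.\<close>

lemma embed_vec_submatrix_mult:
  assumes M: "M \<in> carrier_mat N m" and I: "I \<subseteq> {..<N}" and J: "J \<subseteq> {..<m}"
    and u: "u \<in> carrier_vec (card J)"
    and zero: "\<And>a b. a < N \<Longrightarrow> a \<notin> I \<Longrightarrow> b \<in> J \<Longrightarrow> M $$ (a, b) = 0"
  shows "embed_vec N I (submatrix M I J *\<^sub>v u) = M *\<^sub>v embed_vec m J u"
proof (rule eq_vecI)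
  fix a assume "a < dim_vec (M *\<^sub>v embed_vec m J u)"
  then have a: "a < N" using M by simp
  have fin: "finite I" "finite J" using I J finite_subset by auto
  note S = dim_submatrix_subset[OF M I J]
  have "(M *\<^sub>v embed_vec m J u) $ a =
      (\<Sum>b = 0..<m. M $$ (a, b) * (if b \<in> J then u $ card {x \<in> J. x < b} else 0))"
    using a M by (auto simp: scalar_prod_def embed_vec_def intro!: sum.cong)
  also have "\<dots> = (\<Sum>b\<in>J. M $$ (a, b) * u $ card {x \<in> J. x < b})"
    using J by (intro sum.mono_neutral_cong_right) auto
  also have "\<dots> = embed_vec N I (submatrix M I J *\<^sub>v u) $ a"
  proof (cases "a \<in> I")
    case True
    have lt: "card {x \<in> I. x < a} < card I" by (rule card_less_bound[OF fin(1) True])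
    have "(submatrix M I J *\<^sub>v u) $ card {x \<in> I. x < a} =
        (\<Sum>c = 0..<card J. submatrix M I J $$ (card {x \<in> I. x < a}, c) * u $ c)"
      using lt S u by (auto simp: scalar_prod_def intro!: sum.cong)
    also have "\<dots> = (\<Sum>c = 0..<card J. M $$ (a, pick J c) * u $ c)"
    proof (rule sum.cong)
      fix c assume "c \<in> {0..<card J}"
      then have "submatrix M I J $$ (card {x \<in> I. x < a}, c) = M $$ (pick I (card {x \<in> I. x < a}), pick J c)"
        using carrier_matD[OF S] lt by (intro submatrix_index) (simp_all add: dim_submatrix)
      then show "submatrix M I J $$ (card {x \<in> I. x < a}, c) * u $ c = M $$ (a, pick J c) * u $ c"
        using pick_card_in_set[OF True] by simp
    qed simp
    also have "\<dots> = (\<Sum>b\<in>J. M $$ (a, b) * u $ card {x \<in> J. x < b})"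
      by (rule sum_pick[OF fin(2)])
    finally show ?thesis using a True by (simp add: embed_vec_def)
  next
    case False
    then show ?thesis using a zero by (simp add: embed_vec_def)
  qed
  finally show "embed_vec N I (submatrix M I J *\<^sub>v u) $ a = (M *\<^sub>v embed_vec m J u) $ a" ..
qed (use M in \<open>simp add: embed_vec_def\<close>)

lemma embed_vec_submatrix_power_mult:
  assumes A: "A \<in> carrier_mat N N" and I: "I \<subseteq> {..<N}" and v: "v \<in> carrier_vec (card I)"
    and zero: "\<And>a b. a < N \<Longrightarrow> a \<notin> I \<Longrightarrow> b \<in> I \<Longrightarrow> A $$ (a, b) = 0"
  shows "embed_vec N I (submatrix A I I ^\<^sub>m k *\<^sub>v v) = A ^\<^sub>m k *\<^sub>v embed_vec N I v"
proof -
  note S = dim_submatrix_subset[OF A I I] and Ak = pow_carrier_mat[OF A]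
  note Sk = pow_carrier_mat[OF S]
  show ?thesis
    using v
  proof (induction k arbitrary: v)
    case 0
    then show ?case using S A by simp
  next
    case (Suc k)
    let ?S = "submatrix A I I"
    have Sv: "?S *\<^sub>v v \<in> carrier_vec (card I)" using S Suc.prems by auto
    \<comment> \<open>The power splits off its factor on the right, so one multiplication hits
      \<open>v\<close> first; hence the induction with \<open>v\<close> arbitrary.\<close>
    have "embed_vec N I (?S ^\<^sub>m Suc k *\<^sub>v v) = embed_vec N I (?S ^\<^sub>m k *\<^sub>v (?S *\<^sub>v v))"
      using S Sk Suc.prems by (simp add: assoc_mult_mat_vec[of _ "card I" "card I" _ "card I"])
    also have "\<dots> = A ^\<^sub>m k *\<^sub>v (A *\<^sub>v embed_vec N I v)"
      using Suc.IH[OF Sv] embed_vec_submatrix_mult[OF A I I Suc.prems zero] by simp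
    also have "\<dots> = A ^\<^sub>m Suc k *\<^sub>v embed_vec N I v"
      using A Ak by (simp add: assoc_mult_mat_vec[of _ N N _ N])
    finally show ?case .
  qed
qed

section \<open>Blocks\<close>

lemma block_indices_singleton:
  "block_indices n {i} = {(\<Sum>l = 1..<i. n l)..<(\<Sum>l = 1..<i. n l) + n i}"
  unfolding block_indices_def by (auto simp: le_iff_add)

lemma block_indices_Union:
  "block_indices n S = (\<Union>i\<in>S. block_indices n {i})"
  unfolding block_indices_def by auto

lemma card_block_indices_singleton: "card (block_indices n {i}) = n i"
  by (simp add: block_indices_singleton)

lemma block_end_le:
  fixes n :: "nat \<Rightarrow> nat"
  assumes "1 \<le> i" "i < j"
  shows "(\<Sum>l = 1..<i. n l) + n i \<le> (\<Sum>l = 1..<j. n l)"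
proof -
  have "(\<Sum>l = 1..<i. n l) + n i = (\<Sum>l \<in> {1..<Suc i}. n l)" using assms by simp
  also have "\<dots> \<le> (\<Sum>l = 1..<j. n l)" using assms by (intro sum_mono2) auto
  finally show ?thesis .
qed

lemma block_indices_subset:
  assumes "S \<subseteq> {1..p}"
  shows "block_indices n S \<subseteq> {..<total p n}"
proof -
  \<comment> \<open>The offset of a fictitious block \<open>Suc p\<close> is the total
    dimension.\<close>
  have "(\<Sum>l = 1..<i. n l) + n i \<le> total p n" if "i \<in> S" for i
    using that assms block_end_le[of i "Suc p" n] unfolding total_def
    by (auto simp: atLeastLessThanSuc_atLeastAtMost)
  then show ?thesis by (subst block_indices_Union) (fastforce simp: block_indices_singleton)
qed

lemma block_indices_cover:
  assumes "a < total p n"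
  shows "\<exists>i\<in>{1..p}. a \<in> block_indices n {i}"
  using assms
proof (induction p)
  case 0
  then show ?case by (simp add: total_def)
next
  case (Suc p)
  show ?case
  proof (cases "a < total p n")
    case True
    then show ?thesis using Suc.IH by force
  next
    case False
    then have "a \<in> block_indices n {Suc p}"
      using Suc.prems
      by (simp add: block_indices_singleton total_def atLeastLessThanSuc_atLeastAtMost)
    then show ?thesis by force
  qed
qed

text \<open>Two different blocks are separated by \<open>block_end_le\<close>. Index 0 is excluded
  because its offset would coincide with that of block 1.\<close>

lemma block_indices_disjoint:
  assumes "a \<in> block_indices n {i}" "a \<in> block_indices n {j}" "1 \<le> i" "1 \<le> j"
  shows "i = j"
  using assms block_end_le[of i j n] block_end_le[of j i n]
  by (cases i j rule: linorder_cases) (auto simp: block_indices_singleton)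

text \<open>Turns the blockwise zero condition into an entrywise one: the entry reappears in the
  block submatrix at the ranks of \<open>a\<close> and \<open>b\<close>.\<close>

lemma incidence_mat_zero:
  assumes G: "G \<in> incidence_mat p ord n m" and i: "i \<in> {1..p}" and j: "j \<in> {1..p}"
    and ij: "(j, i) \<notin> ord"
    and a: "a \<in> block_indices n {i}" and b: "b \<in> block_indices m {j}"
  shows "G $$ (a, b) = 0"
proof -
  let ?I = "block_indices n {i}" and ?J = "block_indices m {j}"
  have dim: "G \<in> carrier_mat (total p n) (total p m)"
    and 0: "submatrix G ?I ?J = 0\<^sub>m (n i) (m j)"
    using G i j ij unfolding incidence_mat_def block_submatrix_def by auto
  have "a < total p n" "b < total p m"
    using block_indices_subset[of "{i}" p n] block_indices_subset[of "{j}" p m] i j a b by auto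
  then have "G $$ (a, b) = submatrix G ?I ?J $$ (card {x \<in> ?I. x < a}, card {x \<in> ?J. x < b})"
    using a b dim by (intro submatrix_index_card[symmetric]) auto
  also have "\<dots> = 0"
    using card_less_bound[of ?I a] card_less_bound[of ?J b] a b
    unfolding 0 card_block_indices_singleton by (simp add: block_indices_singleton)
  finally show ?thesis .
qed

section \<open>Orthogonal projection onto local state spaces\<close>

text \<open>An explicit formula for the projection, visibly linear, in place of the definite
  description in \<open>orth_proj\<close>.\<close>

definition coord_part :: "nat \<Rightarrow> nat set \<Rightarrow> real vec \<Rightarrow> real vec" where
  "coord_part N I x = vec N (\<lambda>a. if a \<in> I then x $ a else 0)"

lemma coord_part_carrier [simp]: "coord_part N I x \<in> carrier_vec N"
  by (simp add: coord_part_def)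

lemma is_subspace_coord_part:
  assumes "is_subspace N W"
  shows "is_subspace N (coord_part N I ` W)"
  by (rule is_subspace_image[OF assms]) (auto simp: coord_part_def intro!: eq_vecI)

lemma orth_proj_local_space:
  assumes x: "x \<in> state_space \<Sigma>"
  shows "orth_proj (local_space \<Sigma> S) x = coord_part (state_dim \<Sigma>) (block_indices (nst \<Sigma>) S) x"
proof -
  let ?N = "state_dim \<Sigma>" and ?I = "block_indices (nst \<Sigma>) S" and ?W = "local_space \<Sigma> S"
  let ?w = "coord_part ?N ?I x"
  have dim: "dim_vec u = ?N" if "u \<in> ?W" for u
    using that unfolding local_space_def state_space_def by auto
  show ?thesis
    unfolding orth_proj_def
  proof (rule the_equality, intro conjI ballI)
    show "?w \<in> ?W" by (auto simp: local_space_def state_space_def coord_part_def)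
    show "(x - ?w) \<bullet> u = 0" if u: "u \<in> ?W" for u
      unfolding scalar_prod_def
      by (rule sum.neutral) (use u dim[OF u] in \<open>auto simp: local_space_def coord_part_def\<close>)
  next
    fix w assume w: "w \<in> ?W \<and> (\<forall>u\<in>?W. (x - w) \<bullet> u = 0)"
    show "w = ?w"
    proof (rule eq_vecI)
      fix a assume "a < dim_vec ?w"
      then have a: "a < ?N" by (simp add: coord_part_def)
      show "w $ a = ?w $ a"
      proof (cases "a \<in> ?I")
        case True
        \<comment> \<open>Testing orthogonality against this unit vector reads off entry
          \<open>a\<close> of \<open>x - w\<close>, which gives uniqueness.\<close>
        then have "unit_vec ?N a \<in> ?W"
          using a by (auto simp: local_space_def state_space_def)
        then have "(x - w) \<bullet> unit_vec ?N a = 0" using w by blast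
        moreover have "x - w \<in> carrier_vec ?N"
          using x w dim[of w] by (intro carrier_vecI) (auto simp: state_space_def)
        ultimately have "(x - w) $ a = 0" using a by simp
        then show ?thesis using a x dim[of w] w True by (simp add: coord_part_def)
      next
        case False
        then show ?thesis using a w by (auto simp: local_space_def coord_part_def)
      qed
    qed (use w dim[of w] in \<open>auto simp: coord_part_def\<close>)
  qed
qed

lemma is_subspace_local_space: "is_subspace (state_dim \<Sigma>) (local_space \<Sigma> S)"
  unfolding is_subspace_iff local_space_def state_space_def by auto

lemma local_space_subset: "local_space \<Sigma> S \<subseteq> state_space \<Sigma>"
  unfolding local_space_def by auto

lemma finite_nodes [simp]: "finite (nodes \<Sigma>)"
  by (simp add: nodes_def)

lemma upset_subset: "upset \<Sigma> j \<subseteq> nodes \<Sigma>"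
  by (auto simp: upset_def)

lemma downset_subset: "downset \<Sigma> j \<subseteq> nodes \<Sigma>"
  by (auto simp: downset_def)

lemma finite_upset [simp]: "finite (upset \<Sigma> j)"
  using finite_subset[OF upset_subset] by simp

section \<open>Direct sums of local subspaces\<close>

text \<open>The conditional form lets a sum over the nodes collapse to its single nonzero
  term.\<close>

lemma block_in_local_space:
  assumes "x \<in> local_space \<Sigma> {i}" "i \<in> nodes \<Sigma>" "j \<in> nodes \<Sigma>" "a \<in> block_indices (nst \<Sigma>) {j}"
  shows "x $ a = (if i = j then x $ a else 0)"
proof -
  have "a < state_dim \<Sigma>"
    using assms block_indices_subset[of "{j}" "psize \<Sigma>" "nst \<Sigma>"]
    by (auto simp: nodes_def state_dim_def)
  moreover have "a \<notin> block_indices (nst \<Sigma>) {i}" if "i \<noteq> j"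
    using that block_indices_disjoint[of a "nst \<Sigma>" i j] assms by (auto simp: nodes_def)
  ultimately show ?thesis using assms by (auto simp: local_space_def)
qed

text \<open>The sum is direct: blocks are disjoint, so cutting out block \<open>j\<close> recovers
  exactly the summand taken from \<open>V j\<close>.\<close>

lemma block_sum_part:
  assumes V: "\<And>j. j \<in> nodes \<Sigma> \<Longrightarrow> V j \<subseteq> local_space \<Sigma> {j}"
    and x: "x \<in> block_sum \<Sigma> V" and j: "j \<in> nodes \<Sigma>"
  shows "coord_part (state_dim \<Sigma>) (block_indices (nst \<Sigma>) {j}) x \<in> V j"
proof -
  let ?N = "state_dim \<Sigma>" and ?I = "block_indices (nst \<Sigma>) {j}"
  from x obtain v where v: "\<forall>i\<in>nodes \<Sigma>. v i \<in> V i"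
    and x: "x = finsum_vec TYPE(real) ?N v (nodes \<Sigma>)"
    unfolding block_sum_def subspace_Sum_def by auto
  have loc: "v i \<in> local_space \<Sigma> {i}" if "i \<in> nodes \<Sigma>" for i using that v V by auto
  then have c: "v \<in> nodes \<Sigma> \<rightarrow> carrier_vec ?N"
    using local_space_subset unfolding state_space_def by fastforce
  have "coord_part ?N ?I x = v j"
  proof (rule eq_vecI)
    fix a assume "a < dim_vec (v j)"
    then have a: "a < ?N" using c j by (auto simp: Pi_iff)
    show "coord_part ?N ?I x $ a = v j $ a"
    proof (cases "a \<in> ?I")
      case True
      have "x $ a = (\<Sum>i\<in>nodes \<Sigma>. v i $ a)" unfolding x by (rule index_finsum_vec[OF _ a c]) simp
      also have "\<dots> = (\<Sum>i\<in>nodes \<Sigma>. if i = j then v i $ a else 0)"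
        using block_in_local_space[OF loc _ j True] by (intro sum.cong) auto
      also have "\<dots> = v j $ a" using j by simp
      finally show ?thesis using a True by (simp add: coord_part_def)
    next
      case False
      then show ?thesis using a loc[OF j] by (auto simp: local_space_def coord_part_def)
    qed
  qed (use funcset_mem[OF c j] in \<open>auto simp: coord_part_def\<close>)
  then show ?thesis using v j by auto
qed

text \<open>Each coordinate lies in exactly one block, so \<open>x\<close> is the sum of its block
  parts.\<close>

lemma block_sum_decompose:
  assumes x: "x \<in> state_space \<Sigma>"
    and V: "\<And>j. j \<in> nodes \<Sigma> \<Longrightarrow> coord_part (state_dim \<Sigma>) (block_indices (nst \<Sigma>) {j}) x \<in> V j"
  shows "x \<in> block_sum \<Sigma> V"
proof -
  let ?N = "state_dim \<Sigma>"
  let ?v = "\<lambda>j. coord_part ?N (block_indices (nst \<Sigma>) {j}) x"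
  have c: "?v \<in> nodes \<Sigma> \<rightarrow> carrier_vec ?N" by auto
  have "x = finsum_vec TYPE(real) ?N ?v (nodes \<Sigma>)"
  proof (rule eq_vecI)
    fix a assume "a < dim_vec (finsum_vec TYPE(real) ?N ?v (nodes \<Sigma>))"
    then have a: "a < ?N" using finsum_vec_closed[OF c] by auto
    then obtain i where i: "i \<in> nodes \<Sigma>" "a \<in> block_indices (nst \<Sigma>) {i}"
      using block_indices_cover[of a "psize \<Sigma>" "nst \<Sigma>"] by (auto simp: state_dim_def nodes_def)
    have "a \<in> block_indices (nst \<Sigma>) {j} \<longleftrightarrow> j = i" if "j \<in> nodes \<Sigma>" for j
      using that i block_indices_disjoint[of a "nst \<Sigma>" i j] by (auto simp: nodes_def)
    then have "(\<Sum>j\<in>nodes \<Sigma>. ?v j $ a) = (\<Sum>j\<in>nodes \<Sigma>. if j = i then x $ a else 0)"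
      using a by (intro sum.cong) (auto simp: coord_part_def)
    then show "x $ a = finsum_vec TYPE(real) ?N ?v (nodes \<Sigma>) $ a"
      using i by (subst index_finsum_vec[OF _ a c]) auto
  qed (use finsum_vec_closed[OF c] x in \<open>auto simp: state_space_def\<close>)
  then show ?thesis unfolding block_sum_def subspace_Sum_def using V by blast
qed

section \<open>Poset-causal systems\<close>

abbreviation input_dim :: "poset_system \<Rightarrow> nat" where
  "input_dim \<Sigma> \<equiv> total (psize \<Sigma>) (nin \<Sigma>)"

lemma
  assumes "poset_causal_system \<Sigma>"
  shows sysA_carrier: "sysA \<Sigma> \<in> carrier_mat (state_dim \<Sigma>) (state_dim \<Sigma>)"
    and sysB_carrier: "sysB \<Sigma> \<in> carrier_mat (state_dim \<Sigma>) (input_dim \<Sigma>)"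
  using assms by (auto simp: poset_causal_system_def incidence_mat_def state_dim_def)

lemma block_indices_downset:
  "block_indices (nst \<Sigma>) (downset \<Sigma> j) \<subseteq> {..<state_dim \<Sigma>}"
  using block_indices_subset[of "downset \<Sigma> j"] downset_subset
  by (auto simp: nodes_def state_dim_def)

text \<open>A nonzero entry would put the node of the row below a node of \<open>S\<close>, hence
  below \<open>j\<close> by transitivity. The generality in \<open>m\<close> and \<open>S\<close>
  serves both the state matrix, with the whole downset, and the input matrix, with
  \<open>{j}\<close>.\<close>

lemma downset_zero_row:
  assumes \<Sigma>: "poset_causal_system \<Sigma>" and j: "j \<in> nodes \<Sigma>"
    and G: "G \<in> incidence_mat (psize \<Sigma>) (geq \<Sigma>) (nst \<Sigma>) m"
    and S: "S \<subseteq> downset \<Sigma> j"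
    and a: "a < state_dim \<Sigma>" "a \<notin> block_indices (nst \<Sigma>) (downset \<Sigma> j)"
    and b: "b \<in> block_indices m S"
  shows "G $$ (a, b) = 0"
proof -
  obtain i where i: "i \<in> nodes \<Sigma>" "a \<in> block_indices (nst \<Sigma>) {i}"
    using block_indices_cover[of a "psize \<Sigma>" "nst \<Sigma>"] a by (auto simp: state_dim_def nodes_def)
  obtain l where l: "l \<in> S" "b \<in> block_indices m {l}"
    using b by (subst (asm) block_indices_Union) auto
  have "i \<notin> downset \<Sigma> j" using i a by (subst (asm) (2) block_indices_Union) auto
  moreover have "trans (geq \<Sigma>)"
    using \<Sigma> by (auto simp: poset_causal_system_def partial_order_on_def preorder_on_def)
  ultimately have "(l, i) \<notin> geq \<Sigma>" using S l i by (auto simp: downset_def dest: transD)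
  then show ?thesis
    using incidence_mat_zero[OF G _ _ _ i(2) l(2)] i l S by (auto simp: nodes_def downset_def)
qed

lemma self_in_downset:
  assumes "poset_causal_system \<Sigma>" "j \<in> nodes \<Sigma>"
  shows "j \<in> downset \<Sigma> j"
  using assms
  by (auto simp: poset_causal_system_def partial_order_on_def preorder_on_def refl_on_def downset_def)

section \<open>The downstream reachable set of a fixed node\<close>

context
  fixes \<Sigma> j I J A' B'
  assumes \<Sigma>: "poset_causal_system \<Sigma>" and j: "j \<in> nodes \<Sigma>"
  defines "I \<equiv> block_indices (nst \<Sigma>) (downset \<Sigma> j)" and "J \<equiv> block_indices (nin \<Sigma>) {j}"
  defines "A' \<equiv> submatrix (sysA \<Sigma>) I I" and "B' \<equiv> submatrix (sysB \<Sigma>) I J"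
begin

lemma downset_rows_subset: "I \<subseteq> {..<state_dim \<Sigma>}"
  unfolding I_def by (rule block_indices_downset)

lemma node_cols_subset: "J \<subseteq> {..<input_dim \<Sigma>}"
  unfolding J_def using j by (intro block_indices_subset) (auto simp: nodes_def)

lemma downset_A_carrier: "A' \<in> carrier_mat (card I) (card I)"
  unfolding A'_def by (rule dim_submatrix_subset[OF sysA_carrier[OF \<Sigma>] downset_rows_subset downset_rows_subset])

lemma downset_B_carrier: "B' \<in> carrier_mat (card I) (card J)"
  unfolding B'_def by (rule dim_submatrix_subset[OF sysB_carrier[OF \<Sigma>] downset_rows_subset node_cols_subset])

lemma reach_down_eq: "reach_down \<Sigma> j = embed_vec (state_dim \<Sigma>) I ` reachable A' B'"
  unfolding reach_down_def block_submatrix_def A'_def B'_def I_def J_def ..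

text \<open>The downset is invariant under the global state matrix and receives all inputs at
  \<open>j\<close>, so a generator of the local pair embeds as the global generator for the same
  input.\<close>

lemma embed_vec_reach:
  assumes u: "u \<in> carrier_vec (card J)"
  shows "embed_vec (state_dim \<Sigma>) I (A' ^\<^sub>m k *\<^sub>v (B' *\<^sub>v u)) = sysA \<Sigma> ^\<^sub>m k *\<^sub>v (sysB \<Sigma> *\<^sub>v embed_vec (input_dim \<Sigma>) J u)"
proof -
  have Bu: "B' *\<^sub>v u \<in> carrier_vec (card I)" using downset_B_carrier u by simp
  have "sysA \<Sigma> $$ (a, b) = 0" if "a < state_dim \<Sigma>" "a \<notin> I" "b \<in> I" for a b
    using that \<Sigma> unfolding I_def
    by (intro downset_zero_row[OF \<Sigma> j]) (auto simp: poset_causal_system_def)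
  then have "embed_vec (state_dim \<Sigma>) I (A' ^\<^sub>m k *\<^sub>v (B' *\<^sub>v u)) = sysA \<Sigma> ^\<^sub>m k *\<^sub>v embed_vec (state_dim \<Sigma>) I (B' *\<^sub>v u)"
    unfolding A'_def by (intro embed_vec_submatrix_power_mult sysA_carrier \<Sigma> downset_rows_subset Bu)
  moreover have "sysB \<Sigma> $$ (a, b) = 0" if "a < state_dim \<Sigma>" "a \<notin> I" "b \<in> J" for a b
    using that \<Sigma> self_in_downset[OF \<Sigma> j] unfolding I_def J_def
    by (intro downset_zero_row[OF \<Sigma> j, of _ "nin \<Sigma>" "{j}"]) (auto simp: poset_causal_system_def)
  then have "embed_vec (state_dim \<Sigma>) I (B' *\<^sub>v u) = sysB \<Sigma> *\<^sub>v embed_vec (input_dim \<Sigma>) J u"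
    unfolding B'_def by (intro embed_vec_submatrix_mult sysB_carrier \<Sigma> downset_rows_subset node_cols_subset u)
  ultimately show ?thesis by simp
qed

lemma is_subspace_reach_down: "is_subspace (state_dim \<Sigma>) (reach_down \<Sigma> j)"
  unfolding reach_down_eq
  by (rule is_subspace_image[OF is_subspace_reachable[OF downset_A_carrier]])
     (auto simp: embed_vec_add[OF downset_rows_subset] embed_vec_smult[OF downset_rows_subset])

text \<open>The preimage of the global reachable subspace under the embedding is a subspace
  containing all local generators, so minimality of the local reachable set applies.\<close>

lemma reach_down_subset_reach: "reach_down \<Sigma> j \<subseteq> reach \<Sigma>"
proof -
  have "reachable A' B' \<subseteq> {x \<in> carrier_vec (card I). embed_vec (state_dim \<Sigma>) I x \<in> reach \<Sigma>}"
  proof (rule reachable_least[OF downset_A_carrier downset_B_carrier])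
    show "is_subspace (card I) {x \<in> carrier_vec (card I). embed_vec (state_dim \<Sigma>) I x \<in> reach \<Sigma>}"
      unfolding reach_def
      by (rule is_subspace_vimage[OF is_subspace_reachable[OF sysA_carrier[OF \<Sigma>]]])
         (auto simp: embed_vec_add[OF downset_rows_subset] embed_vec_smult[OF downset_rows_subset])
    fix k c
    have "A' ^\<^sub>m k *\<^sub>v (B' *\<^sub>v unit_vec (card J) c) \<in> carrier_vec (card I)"
      by (intro mult_mat_vec_carrier[OF pow_carrier_mat[OF downset_A_carrier]]
          mult_mat_vec_carrier[OF downset_B_carrier]) simp
    moreover have "embed_vec (state_dim \<Sigma>) I (A' ^\<^sub>m k *\<^sub>v (B' *\<^sub>v unit_vec (card J) c)) \<in> reach \<Sigma>"
      unfolding reach_def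
      by (subst embed_vec_reach) (auto intro!: power_in_reachable sysA_carrier sysB_carrier \<Sigma>)
    ultimately show "A' ^\<^sub>m k *\<^sub>v (B' *\<^sub>v unit_vec (card J) c)
        \<in> {x \<in> carrier_vec (card I). embed_vec (state_dim \<Sigma>) I x \<in> reach \<Sigma>}" by simp
  qed
  then show ?thesis unfolding reach_down_eq by auto
qed

text \<open>The unit input is written as an embedded local one. The exponent may exceed those in the
  local reachability matrix, and \<open>power_in_reachable\<close> for the local pair absorbs
  this.\<close>

lemma power_in_reach_down:
  assumes b: "b \<in> J"
  shows "sysA \<Sigma> ^\<^sub>m k *\<^sub>v (sysB \<Sigma> *\<^sub>v unit_vec (input_dim \<Sigma>) b) \<in> reach_down \<Sigma> j"
  unfolding reach_down_eq embed_vec_unit_vec[OF node_cols_subset b, symmetric]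
  by (subst embed_vec_reach[symmetric])
     (auto intro!: imageI power_in_reachable downset_A_carrier downset_B_carrier)

lemma reach_down_subset_local_space: "reach_down \<Sigma> j \<subseteq> local_space \<Sigma> (downset \<Sigma> j)"
  unfolding reach_down_eq local_space_def state_space_def I_def by (auto simp: embed_vec_def)

end

lemma is_subspace_reach:
  "poset_causal_system \<Sigma> \<Longrightarrow> is_subspace (state_dim \<Sigma>) (reach \<Sigma>)"
  unfolding reach_def by (intro is_subspace_reachable sysA_carrier)

lemma reach_down_subset_state_space:
  assumes "poset_causal_system \<Sigma>" "j \<in> nodes \<Sigma>"
  shows "reach_down \<Sigma> j \<subseteq> state_space \<Sigma>"
  using reach_down_subset_local_space[OF assms] local_space_subset by blast

section \<open>The upper bound on the reachable subspace\<close>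

lemma reach_tilde_comp_eq:
  assumes "poset_causal_system \<Sigma>" "j \<in> nodes \<Sigma>"
  shows "reach_tilde_comp \<Sigma> j i =
    coord_part (state_dim \<Sigma>) (block_indices (nst \<Sigma>) {i}) ` reach_down \<Sigma> j"
  unfolding reach_tilde_comp_def
  using reach_down_subset_state_space[OF assms] orth_proj_local_space
  by (intro image_cong) auto

lemma is_subspace_reach_tilde_comp:
  assumes "poset_causal_system \<Sigma>" "j \<in> nodes \<Sigma>"
  shows "is_subspace (state_dim \<Sigma>) (reach_tilde_comp \<Sigma> j i)"
  unfolding reach_tilde_comp_eq[OF assms]
  by (intro is_subspace_coord_part is_subspace_reach_down assms)

lemma is_subspace_reach_tilde_at:
  assumes "poset_causal_system \<Sigma>"
  shows "is_subspace (state_dim \<Sigma>) (reach_tilde_at \<Sigma> j)"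
  unfolding reach_tilde_at_def using upset_subset
  by (intro is_subspace_subspace_Sum is_subspace_reach_tilde_comp assms) auto

lemma is_subspace_reach_tilde:
  assumes "poset_causal_system \<Sigma>"
  shows "is_subspace (state_dim \<Sigma>) (reach_tilde \<Sigma>)"
  unfolding reach_tilde_def block_sum_def
  by (intro is_subspace_subspace_Sum is_subspace_reach_tilde_at assms) auto

text \<open>A vector is the sum of its block parts. Parts at nodes below \<open>i\<close> are
  projections of the kind that generate \<open>reach_tilde_at\<close>; all others vanish, since the
  vector is supported on the downset of \<open>i\<close>.\<close>

lemma reach_down_subset_reach_tilde:
  assumes \<Sigma>: "poset_causal_system \<Sigma>" and i: "i \<in> nodes \<Sigma>"
  shows "reach_down \<Sigma> i \<subseteq> reach_tilde \<Sigma>"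
proof
  fix x assume x: "x \<in> reach_down \<Sigma> i"
  let ?part = "\<lambda>j. coord_part (state_dim \<Sigma>) (block_indices (nst \<Sigma>) {j}) x"
  show "x \<in> reach_tilde \<Sigma>"
    unfolding reach_tilde_def
  proof (rule block_sum_decompose)
    show "x \<in> state_space \<Sigma>" using x reach_down_subset_state_space[OF \<Sigma> i] by auto
    fix j assume j: "j \<in> nodes \<Sigma>"
    show "?part j \<in> reach_tilde_at \<Sigma> j"
    proof (cases "i \<in> upset \<Sigma> j")
      case True
      have "reach_tilde_comp \<Sigma> i j \<subseteq> reach_tilde_at \<Sigma> j"
        unfolding reach_tilde_at_def using upset_subset
        by (intro subspace_Sum_upper[OF finite_upset True] is_subspace_reach_tilde_comp \<Sigma>) auto
      then show ?thesis using x reach_tilde_comp_eq[OF \<Sigma> i] by auto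
    next
      case False
      have "a \<notin> block_indices (nst \<Sigma>) (downset \<Sigma> i)" if "a \<in> block_indices (nst \<Sigma>) {j}" for a
      proof
        assume "a \<in> block_indices (nst \<Sigma>) (downset \<Sigma> i)"
        then obtain l where l: "l \<in> downset \<Sigma> i" "a \<in> block_indices (nst \<Sigma>) {l}"
          by (subst (asm) block_indices_Union) auto
        then have "l = j"
          using that j by (auto intro!: block_indices_disjoint simp: downset_def nodes_def)
        then show False using False l i by (simp add: downset_def upset_def)
      qed
      moreover have "x \<in> local_space \<Sigma> (downset \<Sigma> i)"
        using x reach_down_subset_local_space[OF \<Sigma> i] by auto
      ultimately have "?part j = 0\<^sub>v (state_dim \<Sigma>)"
        by (intro eq_vecI) (auto simp: coord_part_def local_space_def)
      then show ?thesis using subspace_zero[OF is_subspace_reach_tilde_at[OF \<Sigma>]] by simp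
    qed
  qed
qed

text \<open>Each input coordinate belongs to some node, so each generator already lies in the
  downstream reachable set of that node.\<close>

lemma reach_subset_reach_tilde:
  assumes \<Sigma>: "poset_causal_system \<Sigma>"
  shows "reach \<Sigma> \<subseteq> reach_tilde \<Sigma>"
  unfolding reach_def
proof (rule reachable_least[OF sysA_carrier[OF \<Sigma>] sysB_carrier[OF \<Sigma>] is_subspace_reach_tilde[OF \<Sigma>]])
  fix k b assume "b < input_dim \<Sigma>"
  then obtain j where "j \<in> nodes \<Sigma>" "b \<in> block_indices (nin \<Sigma>) {j}"
    using block_indices_cover[of b "psize \<Sigma>" "nin \<Sigma>"] by (auto simp: nodes_def)
  then show "sysA \<Sigma> ^\<^sub>m k *\<^sub>v (sysB \<Sigma> *\<^sub>v unit_vec (input_dim \<Sigma>) b) \<in> reach_tilde \<Sigma>"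
    using power_in_reach_down[OF \<Sigma>] reach_down_subset_reach_tilde[OF \<Sigma>] by blast
qed

section \<open>Extremality and the lower bounds\<close>

lemma block_sum_subset_reach_circ:
  assumes Q: "\<And>j. j \<in> nodes \<Sigma> \<Longrightarrow> is_subspace (state_dim \<Sigma>) (Q j) \<and> Q j \<subseteq> local_space \<Sigma> {j}"
    and sub: "block_sum \<Sigma> Q \<subseteq> reach \<Sigma>"
  shows "block_sum \<Sigma> Q \<subseteq> reach_circ \<Sigma>"
proof -
  have "Q j \<subseteq> reach_circ_at \<Sigma> j" if j: "j \<in> nodes \<Sigma>" for j
  proof -
    have "Q j \<subseteq> block_sum \<Sigma> Q"
      unfolding block_sum_def using Q by (intro subspace_Sum_upper finite_nodes j) auto
    then show ?thesis unfolding reach_circ_at_def using Q[OF j] sub by blast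
  qed
  then show ?thesis unfolding reach_circ_def block_sum_def by (rule subspace_Sum_mono)
qed

text \<open>A downstream reachable vector lies in the sum of the \<open>S j\<close>, and by
  directness its part in block \<open>j\<close> lies in \<open>S j\<close>. As \<open>S j\<close> is
  a subspace, it absorbs the sum of these parts over the upset.\<close>

lemma reach_tilde_subset_block_sum:
  assumes \<Sigma>: "poset_causal_system \<Sigma>"
    and S: "\<And>j. j \<in> nodes \<Sigma> \<Longrightarrow> is_subspace (state_dim \<Sigma>) (S j) \<and> S j \<subseteq> local_space \<Sigma> {j}"
    and sub: "reach \<Sigma> \<subseteq> block_sum \<Sigma> S"
  shows "reach_tilde \<Sigma> \<subseteq> block_sum \<Sigma> S"
  unfolding reach_tilde_def block_sum_def
proof (rule subspace_Sum_mono)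
  fix j assume j: "j \<in> nodes \<Sigma>"
  have "reach_tilde_comp \<Sigma> i j \<subseteq> S j" if "i \<in> upset \<Sigma> j" for i
  proof -
    have i: "i \<in> nodes \<Sigma>" using that upset_subset by auto
    show ?thesis
      unfolding reach_tilde_comp_eq[OF \<Sigma> i]
      using block_sum_part[of \<Sigma> S _ j] S j sub reach_down_subset_reach[OF \<Sigma> i] by auto
  qed
  then show "reach_tilde_at \<Sigma> j \<subseteq> S j"
    unfolding reach_tilde_at_def using S j by (intro subspace_Sum_least) auto
qed

lemma is_subspace_reach_circ_at:
  "poset_causal_system \<Sigma> \<Longrightarrow> is_subspace (state_dim \<Sigma>) (reach_circ_at \<Sigma> j)"
  unfolding reach_circ_at_def
  by (intro is_subspace_Int is_subspace_local_space is_subspace_reach)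

text \<open>For each node, all summands lie in the one subspace \<open>reach_circ_at\<close>, so
  their sum does too.\<close>

lemma reach_bar_subset_reach_circ:
  assumes \<Sigma>: "poset_causal_system \<Sigma>"
  shows "reach_bar \<Sigma> \<subseteq> reach_circ \<Sigma>"
  unfolding reach_bar_def reach_circ_def block_sum_def
proof (rule subspace_Sum_mono)
  fix j
  have "reach_bar_comp \<Sigma> i j \<subseteq> reach_circ_at \<Sigma> j" if "i \<in> upset \<Sigma> j" for i
    using that reach_down_subset_reach[OF \<Sigma>, of i] upset_subset
    unfolding reach_bar_comp_def reach_circ_at_def by blast
  then show "reach_bar_at \<Sigma> j \<subseteq> reach_circ_at \<Sigma> j"
    unfolding reach_bar_at_def
    by (intro subspace_Sum_least is_subspace_reach_circ_at \<Sigma>) auto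
qed

lemma reach_circ_subset_reach:
  assumes \<Sigma>: "poset_causal_system \<Sigma>"
  shows "reach_circ \<Sigma> \<subseteq> reach \<Sigma>"
  unfolding reach_circ_def block_sum_def
  by (intro subspace_Sum_least is_subspace_reach \<Sigma>) (auto simp: reach_circ_at_def)

theorem theorem3p3:
  fixes \<Sigma> :: poset_system
  assumes "poset_causal_system \<Sigma>"
  shows "(reach_bar \<Sigma> \<subseteq> reach_circ \<Sigma> \<and> reach_circ \<Sigma> \<subseteq> reach \<Sigma> \<and> reach \<Sigma> \<subseteq> reach_tilde \<Sigma>) \<and>
    (independently_controllable \<Sigma> \<longrightarrow> controllable \<Sigma>) \<and>
    (controllable \<Sigma> \<longrightarrow> weakly_upstream_controllable \<Sigma>) \<and>
    (\<forall>Q S :: nat \<Rightarrow> real vec set.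
       (\<forall>j \<in> nodes \<Sigma>.
          is_subspace (state_dim \<Sigma>) (Q j) \<and> Q j \<subseteq> local_space \<Sigma> {j} \<and>
          is_subspace (state_dim \<Sigma>) (S j) \<and> S j \<subseteq> local_space \<Sigma> {j}) \<and>
       block_sum \<Sigma> Q \<subseteq> reach \<Sigma> \<and> reach \<Sigma> \<subseteq> block_sum \<Sigma> S \<longrightarrow>
       block_sum \<Sigma> Q \<subseteq> reach_circ \<Sigma> \<and> reach_tilde \<Sigma> \<subseteq> block_sum \<Sigma> S)"
proof -
  note chain = reach_bar_subset_reach_circ[OF assms] reach_circ_subset_reach[OF assms]
    reach_subset_reach_tilde[OF assms]
  \<comment> \<open>These bounds from above turn the inclusions of the chain into the equalities
    required by the controllability notions.\<close>
  have "reach \<Sigma> \<subseteq> state_space \<Sigma>" "reach_tilde \<Sigma> \<subseteq> state_space \<Sigma>"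
    using subspace_carrier[OF is_subspace_reach[OF assms]]
      subspace_carrier[OF is_subspace_reach_tilde[OF assms]] by (auto simp: state_space_def)
  then have "independently_controllable \<Sigma> \<longrightarrow> controllable \<Sigma>"
    "controllable \<Sigma> \<longrightarrow> weakly_upstream_controllable \<Sigma>"
    using chain unfolding independently_controllable_def controllable_def
      weakly_upstream_controllable_def by auto
  then show ?thesis
    using chain block_sum_subset_reach_circ[of \<Sigma>] reach_tilde_subset_block_sum[OF assms]
    by (metis (no_types, lifting))
qed

end
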